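(* Consider the problem of minimizing $\phi(x):=g(x)-h(x)$ over $x\in\mathbb{R}^n$, where $h:\mathbb{R}^n\to\overline{\mathbb{R}}$ is lower semicontinuous and convex. Let $\bar x\in\mathrm{int}(\mathrm{dom}\,h)$ be a local minimizer of this problem, and let $g$ be of class $\mathcal{C}^{1,1}$ around $\bar x$ ($g$ is not assumed convex). Then the exponent PLK (Polyak-Łojasiewicz-Kurdyka) property of $\phi$ at $\bar x$ with exponent $q$ fails whenever $q\in(0,\frac12)$.
   Context: $\overline{\mathbb{R}}:=\mathbb{R}\cup\{\infty\}$, $\mathrm{dom}\,h:=\{x\in\mathbb{R}^n\mid h(x)<\infty\}$, and $\mathrm{int}$ denotes the interior. The function $g$ is of class $\mathcal{C}^{1,1}$ around $\bar x$ if it is continuously differentiable with Lipschitz continuous gradient on a neighborhood of $\bar x$. For $x$ near $\bar x$ (where $\phi$ is finite and continuous), the regular subdifferential $\widehat\partial\phi(x)$ is the set of $v\in\mathbb{R}^n$ with $\liminf_{u\to x,\,u\ne x}\frac{\phi(u)-\phi(x)-\langle v,u-x\rangle}{\|u-x\|}\ge 0$, and the limiting (Mordukhovich) subdifferential is $$\partial\phi(x):=\{v\in\mathbb{R}^n\mid \exists\, x_k\to x,\ \phi(x_k)\to\phi(x),\ v_k\in\widehat\partial\phi(x_k),\ v_k\to v\}.$$ Exponent PLK property of $\phi$ at $\bar x$ with exponent $q\in[0,1)$ (that is, with desingularizing function $\varphi(t)=Mt^{1-q}$): there exist $M>0$, $\eta\in(0,\infty)$ and a neighborhood $U$ of $\bar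 x$ such that $$M(1-q)\big(\phi(x)-\phi(\bar x)\big)^{-q}\,\mathrm{dist}\big(0,\partial\phi(x)\big)\ge 1\quad\text{for all }x\in U\text{ with }\phi(\bar x)<\phi(x)<\phi(\bar x)+\eta.$$
   Formalization: The formal theorem additionally assumes that φ is not constant on any neighborhood of x̄; if φ is constant around x̄ (e.g. g = h = 0), the PLK property holds vacuously for every exponent and the claim is false. *)

theory Defs
  imports "HOL-Analysis.Analysis"
begin

text \<open>
  Extended-real-valued functions with values in \<open>\<real> \<union> {\<infinity>}\<close> are functions into
  \<^typ>\<open>ereal\<close>; where the value \<open>-\<infinity>\<close> has to be excluded, this is a separate hypothesis.
\<close>

definition lsc :: "('a::topological_space \<Rightarrow> ereal) \<Rightarrow> bool" where
  "lsc f \<longleftrightarrow> (\<forall>x. f x \<le> Liminf (at x) f)"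

text \<open>The following is the usual convexity for functions that never take the value \<open>-\<infinity>\<close>.\<close>

definition econvex :: "('a::real_vector \<Rightarrow> ereal) \<Rightarrow> bool" where
  "econvex f \<longleftrightarrow> (\<forall>x y t. 0 < t \<and> t < 1 \<longrightarrow>
     f ((1 - t) *\<^sub>R x + t *\<^sub>R y) \<le> ereal (1 - t) * f x + ereal t * f y)"

definition local_minimizer :: "('a::topological_space \<Rightarrow> ereal) \<Rightarrow> 'a \<Rightarrow> bool" where
  "local_minimizer \<phi> xb \<longleftrightarrow> (\<forall>\<^sub>F x in nhds xb. \<phi> xb \<le> \<phi> x)"

text \<open>Continuity of the gradient is implied by its Lipschitz continuity.\<close>

definition C11_around :: "('a::euclidean_space \<Rightarrow> ereal) \<Rightarrow> 'a \<Rightarrow> bool" where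
  "C11_around g xb \<longleftrightarrow> (\<exists>U G L. open U \<and> xb \<in> U \<and>
     (\<forall>x\<in>U. \<bar>g x\<bar> \<noteq> \<infinity> \<and> (GDERIV (\<lambda>u. real_of_ereal (g u)) x :> G x)) \<and>
     L-lipschitz_on U G)"

definition regular_subdifferential ::
  "('a::euclidean_space \<Rightarrow> ereal) \<Rightarrow> 'a \<Rightarrow> 'a set" where
  "regular_subdifferential \<phi> x = {v. \<bar>\<phi> x\<bar> \<noteq> \<infinity> \<and>
     0 \<le> Liminf (at x)
           (\<lambda>u. (\<phi> u - \<phi> x - ereal (v \<bullet> (u - x))) / ereal (norm (u - x)))}"

definition limiting_subdifferential ::
  "('a::euclidean_space \<Rightarrow> ereal) \<Rightarrow> 'a \<Rightarrow> 'a set" where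
  "limiting_subdifferential \<phi> x = {v. \<bar>\<phi> x\<bar> \<noteq> \<infinity> \<and>
     (\<exists>X V. X \<longlonglongrightarrow> x \<and> (\<lambda>k. \<phi> (X k)) \<longlonglongrightarrow> \<phi> x \<and>
        (\<forall>k. V k \<in> regular_subdifferential \<phi> (X k)) \<and> V \<longlonglongrightarrow> v)}"

text \<open>
  Distance of the origin to a set with the convention \<open>dist(0, \<emptyset>) = \<infinity>\<close>
  (whereas \<^const>\<open>infdist\<close> is \<open>0\<close> on the empty set).
\<close>

definition dist_zero :: "'a::real_normed_vector set \<Rightarrow> ereal" where
  "dist_zero S = (INF v\<in>S. ereal (norm v))"

definition exponent_PLK ::
  "('a::euclidean_space \<Rightarrow> ereal) \<Rightarrow> 'a \<Rightarrow> real \<Rightarrow> bool" where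
  "exponent_PLK \<phi> xb q \<longleftrightarrow>
     (\<exists>(M::real) (\<eta>::real) U. M > 0 \<and> \<eta> > 0 \<and> open U \<and> xb \<in> U \<and>
        (\<forall>x\<in>U. \<phi> xb < \<phi> x \<and> \<phi> x < \<phi> xb + ereal \<eta> \<longrightarrow>
           ereal (M * (1 - q) * real_of_ereal (\<phi> x - \<phi> xb) powr (- q))
             * dist_zero (limiting_subdifferential \<phi> x) \<ge> 1))"

text \<open>
  The defining inequality only concerns points with \<open>\<phi> x > \<phi> xb\<close>, so the property holds
  vacuously for every exponent if \<open>\<phi>\<close> is constant around \<open>xb\<close>.  Results asserting that the
  property fails therefore have to exclude this case.
\<close>

lemma exponent_PLK_locally_constant:
  assumes "\<forall>\<^sub>F x in nhds xb. \<phi> x = \<phi> xb"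
  shows "exponent_PLK \<phi> xb q"
proof -
  obtain U where U: "open U" "xb \<in> U" and const: "\<And>x. x \<in> U \<Longrightarrow> \<phi> x = \<phi> xb"
    using assms unfolding eventually_nhds by blast
  have "\<not> \<phi> xb < \<phi> x" if "x \<in> U" for x
    using const[OF that] by simp
  then show ?thesis
    unfolding exponent_PLK_def using U zero_less_one by blast
qed

end

theory Submission
  imports Defs
begin

text \<open>
  Write \<open>\<phi> = g - h\<close> and \<open>\<delta>(x) = \<phi>(x) - \<phi>(xb) \<ge> 0\<close>.  The property with exponent \<open>q\<close> asks for subgradients
  of size at least a constant times \<open>\<delta>\<^sup>q\<close>.  Subtracting a convex function can only bend \<open>\<phi>\<close> downwards,
  so \<open>\<phi>\<close> is as flat from above as the smooth function \<open>g\<close>, and this forces subgradients of size at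
  most a constant times \<open>\<surd>\<delta>\<close>; for \<open>q < 1/2\<close> the two bounds are incompatible once \<open>\<delta>\<close> is small.

  In detail, let \<open>v\<close> be a regular subgradient of \<open>\<phi>\<close> at \<open>u\<close>.  Then \<open>h\<close> lies, to first order, below the
  affine function with slope \<open>s = \<nabla>g(u) - v\<close>.  For a convex function this makes \<open>s\<close> a genuine
  subgradient (\<open>convex_on_subgradient_if_first_order_upper_bound\<close>): the slope of \<open>h\<close> from \<open>u\<close>
  to \<open>y\<close> is at least its slope up to \<open>u\<close> from a point just beyond \<open>u\<close> on the other side.  Together with the
  quadratic upper bound for \<open>g\<close> this yields
  \<open>\<phi>(y) \<le> \<phi>(u) + \<langle>v, y - u\<rangle> + L \<parallel>y - u\<parallel>\<^sup>2\<close> for all \<open>y\<close> near \<open>xb\<close>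
  (\<open>regular_subgradient_quadratic_upper_bound\<close>).  Moving from \<open>u\<close> by \<open>\<surd>\<delta>(u)\<close> in direction \<open>-v\<close> cannot
  take \<open>\<phi>\<close> below its local minimum \<open>\<phi>(xb)\<close>, which gives \<open>\<parallel>v\<parallel> \<le> (1 + L) \<surd>\<delta>(u)\<close>.

  Regular subgradients exist at points \<open>u\<close> arbitrarily close to \<open>xb\<close> with \<open>\<phi>(u) > \<phi>(xb)\<close>: since \<open>\<phi>\<close> is
  continuous and not locally constant, \<open>{\<phi> > \<phi>(xb)}\<close> contains small balls arbitrarily close to \<open>xb\<close>,
  and inside any ball some paraboloid touches the graph of \<open>\<phi>\<close> from below
  (\<open>ex_proximal_subgradient_in_ball\<close>).
\<close>

section \<open>Convex functions and functions with Lipschitz gradient\<close>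

text \<open>
  Convexity at the three points \<open>u - t d\<close>, \<open>u\<close>, \<open>u + d\<close> with \<open>d = y - u\<close> bounds the slope of \<open>f\<close> from
  \<open>u\<close> to \<open>y\<close> from below by its slope from \<open>u - t d\<close> to \<open>u\<close>, and the latter is at least
  \<open>\<langle>s, d\<rangle> - o(1)\<close> as \<open>t \<rightarrow> 0\<close> because of the upper bound at \<open>u - t d\<close>.
\<close>

lemma convex_on_subgradient_if_first_order_upper_bound:
  fixes f :: "'a::real_inner \<Rightarrow> real"
  assumes f: "convex_on S f" and S: "open S" "u \<in> S" "y \<in> S"
    and upper: "\<And>e. e > 0 \<Longrightarrow> \<forall>\<^sub>F z in nhds u. f z \<le> f u + s \<bullet> (z - u) + e * norm (z - u)"
  shows "f u + s \<bullet> (y - u) \<le> f y"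
proof -
  define d where "d = y - u"
  have "s \<bullet> d \<le> f y - f u + e * norm d" if e: "e > 0" for e
  proof -
    have "((\<lambda>t. u - t *\<^sub>R d) \<longlongrightarrow> u - 0 *\<^sub>R d) (at_right (0::real))"
      by (intro tendsto_intros)
    then have lim: "filterlim (\<lambda>t. u - t *\<^sub>R d) (nhds u) (at_right (0::real))"
      by simp
    have "\<forall>\<^sub>F z in nhds u. z \<in> S"
      using S by (simp add: eventually_nhds_in_open)
    then have "\<forall>\<^sub>F z in nhds u. z \<in> S \<and> f z \<le> f u + s \<bullet> (z - u) + e * norm (z - u)"
      using upper[OF e] by eventually_elim simp
    then have "\<forall>\<^sub>F t in at_right (0::real). u - t *\<^sub>R d \<in> S \<and>
        f (u - t *\<^sub>R d) \<le> f u + s \<bullet> (u - t *\<^sub>R d - u) + e * norm (u - t *\<^sub>R d - u)"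
      using lim by (rule eventually_compose_filterlim)
    moreover have "\<forall>\<^sub>F t in at_right (0::real). t > 0"
      by (simp add: eventually_at_filter)
    ultimately have "\<forall>\<^sub>F t in at_right (0::real). t > 0 \<and> u - t *\<^sub>R d \<in> S \<and>
        f (u - t *\<^sub>R d) \<le> f u + s \<bullet> (u - t *\<^sub>R d - u) + e * norm (u - t *\<^sub>R d - u)"
      by eventually_elim simp
    then obtain t where t: "t > 0" "u - t *\<^sub>R d \<in> S"
      and "f (u - t *\<^sub>R d) \<le> f u + s \<bullet> (u - t *\<^sub>R d - u) + e * norm (u - t *\<^sub>R d - u)"
      using eventually_happens'[OF trivial_limit_at_right_real] by blast
    then have ft: "f (u - t *\<^sub>R d) \<le> f u - t * (s \<bullet> d) + e * (t * norm d)"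
      by simp
    \<comment> \<open>The weight with which \<open>u\<close> is a convex combination of \<open>y\<close> and \<open>u - t d\<close>.\<close>
    define c where "c = 1 / (1 + t)"
    have c: "0 \<le> c" "c * t = 1 - c" "(1 + t) * c = 1" "0 \<le> 1 - c"
      using t by (auto simp: c_def field_simps)
    have "(1 - c) *\<^sub>R y + c *\<^sub>R (u - t *\<^sub>R d) = (1 - c) *\<^sub>R y + c *\<^sub>R u - (c * t) *\<^sub>R d"
      by (simp add: algebra_simps)
    also have "\<dots> = u"
      unfolding c d_def by (simp add: algebra_simps)
    finally have "f u \<le> (1 - c) * f y + c * f (u - t *\<^sub>R d)"
      using convex_onD[OF f, of c y "u - t *\<^sub>R d"] S t c by simp
    then have "(1 + t) * f u \<le> (1 + t) * ((1 - c) * f y + c * f (u - t *\<^sub>R d))"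
      using t by (intro mult_left_mono) auto
    also have "\<dots> = ((1 + t) - (1 + t) * c) * f y + ((1 + t) * c) * f (u - t *\<^sub>R d)"
      by (simp add: algebra_simps)
    also have "\<dots> = t * f y + f (u - t *\<^sub>R d)"
      unfolding c by simp
    finally have "t * (s \<bullet> d) \<le> t * (f y - f u + e * norm d)"
      using ft by (simp add: algebra_simps)
    then show ?thesis
      using t by simp
  qed
  note approx = this
  have "s \<bullet> d \<le> f y - f u"
  proof (rule field_le_epsilon)
    fix e :: real assume "e > 0"
    then have "s \<bullet> d \<le> f y - f u + e / (norm d + 1) * norm d"
      by (intro approx) (simp add: add_nonneg_pos)
    also have "e / (norm d + 1) * norm d \<le> e"
      using \<open>e > 0\<close> by (simp add: field_simps add_nonneg_pos add_pos_nonneg)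
    finally show "s \<bullet> d \<le> f y - f u + e" by simp
  qed
  then show ?thesis by (simp add: d_def)
qed

text \<open>
  The mean value inequality for the deviation from the linearization at \<open>u\<close> gives the constant \<open>L\<close>
  instead of the sharp \<open>L / 2\<close>; any constant serves the purpose here.
\<close>

lemma lipschitz_gradient_quadratic_upper_bound:
  fixes g :: "'a::real_inner \<Rightarrow> real"
  assumes S: "convex S" "u \<in> S" "y \<in> S"
    and g: "\<And>x. x \<in> S \<Longrightarrow> GDERIV g x :> G x" and G: "L-lipschitz_on S G"
  shows "g y \<le> g u + G u \<bullet> (y - u) + L * (norm (y - u))\<^sup>2"
proof -
  have seg: "closed_segment u y \<subseteq> S"
    using S by (simp add: closed_segment_subset)
  have "norm (g y - g u - (y - u) \<bullet> G u) \<le> norm (y - u) * (L * norm (y - u))"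
  proof (rule differentiable_bound_linearization[where S = "closed_segment u y"
        and f' = "\<lambda>x h. h \<bullet> G x" and ?x0.0 = u])
    show "u + t *\<^sub>R (y - u) \<in> closed_segment u y" if "t \<in> {0..1}" for t
      using that by (auto simp: in_segment algebra_simps intro!: exI[of _ t])
    show "(g has_derivative (\<lambda>h. h \<bullet> G x)) (at x within closed_segment u y)"
      if "x \<in> closed_segment u y" for x
      using g[of x] seg that by (auto simp: gderiv_def intro: has_derivative_at_withinI)
    show "onorm ((\<lambda>h. h \<bullet> G x) - (\<lambda>h. h \<bullet> G u)) \<le> L * norm (y - u)"
      if x: "x \<in> closed_segment u y" for x
    proof (rule onorm_bound)
      show "0 \<le> L * norm (y - u)"
        using lipschitz_on_nonneg[OF G] by simp
      fix h
      have "norm (((\<lambda>h. h \<bullet> G x) - (\<lambda>h. h \<bullet> G u)) h) = \<bar>h \<bullet> (G x - G u)\<bar>"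
        by (simp add: inner_diff_right)
      also have "\<dots> \<le> norm h * norm (G x - G u)"
        by (rule Cauchy_Schwarz_ineq2)
      also have "norm (G x - G u) \<le> L * norm (x - u)"
        using lipschitz_onD[OF G, of x u] x seg S by (auto simp: dist_norm)
      also have "L * norm (x - u) \<le> L * norm (y - u)"
        using lipschitz_on_nonneg[OF G] segment_bound1[OF x] by (simp add: mult_left_mono)
      finally show "norm (((\<lambda>h. h \<bullet> G x) - (\<lambda>h. h \<bullet> G u)) h) \<le> L * norm (y - u) * norm h"
        by (simp add: mult_left_mono mult.commute[of _ "norm h"])
    qed
  qed simp
  then show ?thesis
    by (simp add: inner_commute power2_eq_square algebra_simps)
qed

section \<open>Regular subgradients of real-valued functions\<close>

text \<open>
  Membership in \<^const>\<open>regular_subdifferential\<close> for functions with finite values, without the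
  difference quotients; the case \<open>y = x\<close> is trivially true, so that the full neighbourhood filter
  can be used.
\<close>

definition regular_subgradient :: "('a::real_inner \<Rightarrow> real) \<Rightarrow> 'a \<Rightarrow> 'a \<Rightarrow> bool" where
  "regular_subgradient f x v \<longleftrightarrow>
     (\<forall>e>0. \<forall>\<^sub>F y in nhds x. f x + v \<bullet> (y - x) - e * norm (y - x) \<le> f y)"

lemma regular_subgradient_imp_limiting_subdifferential:
  fixes \<phi> :: "'a::euclidean_space \<Rightarrow> ereal"
  assumes fin: "\<forall>\<^sub>F y in nhds x. \<phi> y = ereal (f y)" and v: "regular_subgradient f x v"
  shows "v \<in> limiting_subdifferential \<phi> x"
proof -
  have x: "\<phi> x = ereal (f x)"
    using eventually_nhds_x_imp_x[OF fin] .
  have "0 \<le> Liminf (at x) (\<lambda>u. (\<phi> u - \<phi> x - ereal (v \<bullet> (u - x))) / ereal (norm (u - x)))"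
    unfolding le_Liminf_iff
  proof (intro allI impI)
    fix c :: ereal assume "c < 0"
    then obtain b where "c < ereal b" "b < 0"
      using ereal_dense2[of c 0] by auto
    then obtain e where e: "c < ereal (- e)" "e > 0"
      by (metis minus_minus neg_0_less_iff_less)
    have "\<forall>\<^sub>F y in at x. \<phi> y = ereal (f y) \<and> f x + v \<bullet> (y - x) - e * norm (y - x) \<le> f y \<and> y \<noteq> x"
      using fin v e unfolding regular_subgradient_def eventually_at_filter
      by (auto elim: eventually_elim2)
    then show "\<forall>\<^sub>F y in at x. c < (\<phi> y - \<phi> x - ereal (v \<bullet> (y - x))) / ereal (norm (y - x))"
    proof eventually_elim
      case (elim y)
      then have "- e \<le> (f y - f x - v \<bullet> (y - x)) / norm (y - x)"
        by (simp add: field_simps)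
      then have "ereal (- e) \<le> (\<phi> y - \<phi> x - ereal (v \<bullet> (y - x))) / ereal (norm (y - x))"
        using elim x by simp
      with e(1) show ?case by (rule less_le_trans)
    qed
  qed
  then have "v \<in> regular_subdifferential \<phi> x"
    using x by (simp add: regular_subdifferential_def)
  then have "(\<lambda>k. x) \<longlonglongrightarrow> x \<and> (\<lambda>k. \<phi> x) \<longlonglongrightarrow> \<phi> x \<and>
      (\<forall>k::nat. v \<in> regular_subdifferential \<phi> x) \<and> (\<lambda>k. v) \<longlonglongrightarrow> v"
    by simp
  then have "\<exists>X V. X \<longlonglongrightarrow> x \<and> (\<lambda>k. \<phi> (X k)) \<longlonglongrightarrow> \<phi> x \<and>
      (\<forall>k. V k \<in> regular_subdifferential \<phi> (X k)) \<and> V \<longlonglongrightarrow> v"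
    by (intro exI[of _ "\<lambda>k. x"] exI[of _ "\<lambda>k. v"])
  then show ?thesis
    using x by (simp add: limiting_subdifferential_def)
qed

text \<open>
  The term \<open>K \<parallel>y - a\<parallel>\<^sup>2\<close> with large \<open>K\<close> pushes the minimizer \<open>u\<close> of
  \<open>f(y) + K \<parallel>y - a\<parallel>\<^sup>2\<close> over the closed ball into the interior, and \<open>- 2 K (u - a)\<close> is
  then the slope at \<open>u\<close> of a paraboloid that touches \<open>f\<close> from below.
\<close>

lemma ex_proximal_subgradient_in_ball:
  fixes f :: "'a::euclidean_space \<Rightarrow> real"
  assumes f: "continuous_on (cball a r) f" and r: "r > 0"
  obtains u v K where "u \<in> ball a r"
    "\<And>y. y \<in> cball a r \<Longrightarrow> f u + v \<bullet> (y - u) - K * (norm (y - u))\<^sup>2 \<le> f y"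
proof -
  have "cball a r \<noteq> {}"
    using r by simp
  note attains_inf = continuous_attains_inf[OF compact_cball this]
  obtain m where m: "\<And>y. y \<in> cball a r \<Longrightarrow> f m \<le> f y"
    using attains_inf[OF f] by blast
  \<comment> \<open>On the sphere the penalised function exceeds its value at the centre.\<close>
  define K where "K = (f a - f m + 1) / r\<^sup>2"
  have Kr: "K * r\<^sup>2 = f a - f m + 1"
    using r by (simp add: K_def)
  have "continuous_on (cball a r) (\<lambda>y. f y + K * (norm (y - a))\<^sup>2)"
    by (intro continuous_intros f)
  then obtain u where u: "u \<in> cball a r"
    and min: "\<And>y. y \<in> cball a r \<Longrightarrow> f u + K * (norm (u - a))\<^sup>2 \<le> f y + K * (norm (y - a))\<^sup>2"
    using attains_inf by blast
  have "norm (u - a) \<noteq> r"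
    using min[of a] m[OF u] Kr r by auto
  with u have "u \<in> ball a r"
    by (simp add: dist_norm norm_minus_commute)
  moreover have "f u + (- 2 * K) *\<^sub>R (u - a) \<bullet> (y - u) - K * (norm (y - u))\<^sup>2 \<le> f y"
    if "y \<in> cball a r" for y
  proof -
    have "(norm (y - a))\<^sup>2 = (norm ((y - u) + (u - a)))\<^sup>2"
      by simp
    also have "\<dots> = (norm (y - u))\<^sup>2 + 2 * ((u - a) \<bullet> (y - u)) + (norm (u - a))\<^sup>2"
      unfolding power2_norm_eq_inner inner_add_left inner_add_right by (simp add: inner_commute)
    finally have "K * (norm (y - a))\<^sup>2 =
        K * (norm (y - u))\<^sup>2 + 2 * K * ((u - a) \<bullet> (y - u)) + K * (norm (u - a))\<^sup>2"
      by (simp add: distrib_left)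
    then show ?thesis
      using min[OF that] by simp
  qed
  ultimately show thesis
    using that by blast
qed

lemma proximal_imp_regular_subgradient:
  fixes f :: "'a::real_inner \<Rightarrow> real"
  assumes "\<forall>\<^sub>F y in nhds x. f x + v \<bullet> (y - x) - K * (norm (y - x))\<^sup>2 \<le> f y"
  shows "regular_subgradient f x v"
  unfolding regular_subgradient_def
proof (intro allI impI)
  fix e :: real assume "e > 0"
  have "((\<lambda>y. K * norm (y - x)) \<longlongrightarrow> K * norm (x - x)) (nhds x)"
    by (intro tendsto_intros filterlim_ident)
  then have "\<forall>\<^sub>F y in nhds x. K * norm (y - x) < e"
    by (rule order_tendstoD(2)) (use \<open>e > 0\<close> in simp)
  with assms show "\<forall>\<^sub>F y in nhds x. f x + v \<bullet> (y - x) - e * norm (y - x) \<le> f y"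
  proof eventually_elim
    case (elim y)
    have "K * norm (y - x) * norm (y - x) \<le> e * norm (y - x)"
      using elim by (intro mult_right_mono) auto
    with elim show ?case by (simp add: power2_eq_square)
  qed
qed

section \<open>Differences of a smooth and a convex function\<close>

text \<open>
  A regular subgradient is a purely local notion, but the slope \<open>G u - v\<close> that it induces for the
  convex part is a subgradient on all of \<open>S\<close>.  The bound is therefore uniform: the neighbourhood
  on which it holds does not shrink with the choice of \<open>u\<close> or \<open>v\<close>.
\<close>

lemma regular_subgradient_quadratic_upper_bound:
  fixes g h :: "'a::real_inner \<Rightarrow> real"
  assumes S: "open S" "convex S" "u \<in> S" "y \<in> S"
    and g: "\<And>x. x \<in> S \<Longrightarrow> GDERIV g x :> G x" and G: "L-lipschitz_on S G"
    and h: "convex_on S h" and v: "regular_subgradient (\<lambda>x. g x - h x) u v"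
  shows "g y - h y \<le> g u - h u + v \<bullet> (y - u) + L * (norm (y - u))\<^sup>2"
proof -
  have "h u + (G u - v) \<bullet> (y - u) \<le> h y"
  proof (rule convex_on_subgradient_if_first_order_upper_bound[OF h \<open>open S\<close> S(3,4)])
    fix e :: real assume "e > 0"
    have 1: "\<forall>\<^sub>F z in nhds u. g z \<le> g u + G u \<bullet> (z - u) + e / 2 * norm (z - u)"
    proof -
      have "((\<lambda>z. L * norm (z - u)) \<longlongrightarrow> L * norm (u - u)) (nhds u)"
        by (intro tendsto_intros filterlim_ident)
      then have "\<forall>\<^sub>F z in nhds u. L * norm (z - u) < e / 2"
        by (rule order_tendstoD(2)) (use \<open>e > 0\<close> in simp)
      moreover have "\<forall>\<^sub>F z in nhds u. z \<in> S"
        using S by (simp add: eventually_nhds_in_open)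
      ultimately show ?thesis
      proof eventually_elim
        case (elim z)
        have "L * norm (z - u) * norm (z - u) \<le> e / 2 * norm (z - u)"
          using elim by (intro mult_right_mono) auto
        with lipschitz_gradient_quadratic_upper_bound[OF S(2,3) elim(2) g G]
        show ?case by (simp add: power2_eq_square)
      qed
    qed
    have 2: "\<forall>\<^sub>F z in nhds u. g u - h u + v \<bullet> (z - u) - e / 2 * norm (z - u) \<le> g z - h z"
      using v \<open>e > 0\<close> unfolding regular_subgradient_def by (metis half_gt_zero)
    from 1 2 show "\<forall>\<^sub>F z in nhds u. h z \<le> h u + (G u - v) \<bullet> (z - u) + e * norm (z - u)"
      by eventually_elim (simp add: inner_diff_left)
  qed
  with lipschitz_gradient_quadratic_upper_bound[OF S(2,3,4) g G]
  show ?thesis by (simp add: inner_diff_left)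
qed

text \<open>
  A step of length \<open>\<surd>\<delta>\<close> in direction \<open>- v\<close> balances the two terms \<open>\<delta> / t\<close> and \<open>L t\<close> that bound
  \<open>norm v\<close> when the step has length \<open>t\<close>.
\<close>

lemma norm_le_sqrt_if_quadratic_upper_bound:
  fixes f :: "'a::real_inner \<Rightarrow> real"
  assumes upper: "\<And>y. y \<in> cball u (sqrt \<delta>) \<Longrightarrow> f y \<le> f u + v \<bullet> (y - u) + L * (norm (y - u))\<^sup>2"
    and lower: "\<And>y. y \<in> cball u (sqrt \<delta>) \<Longrightarrow> f u - \<delta> \<le> f y"
    and \<delta>: "\<delta> > 0" and L: "L \<ge> 0"
  shows "norm v \<le> (1 + L) * sqrt \<delta>"
proof (cases "v = 0")
  case False
  define t where "t = sqrt \<delta>"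
  have t: "t > 0" "\<delta> = t * t"
    using \<delta> by (auto simp: t_def)
  define y where "y = u - (t / norm v) *\<^sub>R v"
  have y: "norm (y - u) = t" "v \<bullet> (y - u) = - (t * norm v)"
    using False t by (auto simp: y_def dot_square_norm power2_eq_square)
  then have "y \<in> cball u (sqrt \<delta>)"
    by (simp add: dist_norm norm_minus_commute t_def)
  from lower[OF this] upper[OF this] have "t * norm v \<le> t * ((1 + L) * t)"
    using y t by (simp add: algebra_simps power2_eq_square)
  then have "norm v \<le> (1 + L) * t"
    using t(1) by simp
  then show ?thesis
    by (simp add: t_def)
qed (use \<delta> L in simp)

text \<open>
  The subgradients that violate the exponent: at points as close to the minimizer, and with values
  as little above the minimum, as desired.
\<close>

lemma ex_small_regular_subgradient:
  fixes g h \<phi> :: "'a::euclidean_space \<Rightarrow> real"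
  assumes \<phi>_def: "\<phi> = (\<lambda>x. g x - h x)" and R: "R > 0"
    and g: "\<And>x. x \<in> ball a R \<Longrightarrow> GDERIV g x :> G x" and G: "L-lipschitz_on (ball a R) G"
    and h: "convex_on (ball a R) h"
    and min: "\<And>x. x \<in> ball a R \<Longrightarrow> \<phi> a \<le> \<phi> x"
    and nonconst: "\<not> (\<forall>\<^sub>F x in nhds a. \<phi> x = \<phi> a)"
    and U: "open U" "a \<in> U" and \<epsilon>: "\<epsilon> > 0"
  obtains u v where "u \<in> ball a R" "u \<in> U" "\<phi> a < \<phi> u" "\<phi> u < \<phi> a + \<epsilon>"
    "regular_subgradient \<phi> u v"
    "norm v \<le> (1 + L) * sqrt (\<phi> u - \<phi> a)"
proof -
  have "continuous_on (ball a R) g"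
    using has_derivative_continuous[OF g[unfolded gderiv_def]]
    by (intro continuous_at_imp_continuous_on ballI)
  then have cont: "continuous_on (ball a R) \<phi>"
    unfolding \<phi>_def using convex_on_continuous[OF open_ball h] by (intro continuous_on_diff)
  \<comment> \<open>Values below \<open>\<phi> a + (R / 2)\<^sup>2\<close> near \<open>a\<close> keep the step of length \<open>sqrt (\<phi> u - \<phi> a)\<close> inside the ball.\<close>
  define m where "m = min \<epsilon> ((R / 2)\<^sup>2)"
  have m: "m > 0" "m \<le> \<epsilon>" "m \<le> (R / 2)\<^sup>2"
    using \<epsilon> R by (auto simp: m_def)
  have "isCont \<phi> a"
    using cont R by (simp add: continuous_on_eq_continuous_at)
  then have "(\<phi> \<longlongrightarrow> \<phi> a) (nhds a)"
    by (simp add: continuous_at tendsto_at_iff_tendsto_nhds)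
  then have "\<forall>\<^sub>F x in nhds a. \<phi> x < \<phi> a + m"
    by (rule order_tendstoD(2)) (use m in simp)
  moreover have "\<forall>\<^sub>F x in nhds a. x \<in> U \<inter> ball a (R / 2)"
    using U R by (intro eventually_nhds_in_open) auto
  ultimately have "\<forall>\<^sub>F x in nhds a. x \<in> U \<inter> ball a (R / 2) \<and> \<phi> x < \<phi> a + m"
    by eventually_elim simp
  then obtain W where W: "open W" "a \<in> W"
    and WP: "\<And>x. x \<in> W \<Longrightarrow> x \<in> U \<inter> ball a (R / 2) \<and> \<phi> x < \<phi> a + m"
    unfolding eventually_nhds by blast
  have WR: "W \<subseteq> ball a R"
    using WP R by fastforce
  obtain b where b: "b \<in> W" "\<phi> b \<noteq> \<phi> a"
    using nonconst W unfolding eventually_nhds by blast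
  have "open {x \<in> W. \<phi> x \<in> {\<phi> a<..}}"
    using continuous_open_preimage[OF continuous_on_subset[OF cont WR] W(1) open_greaterThan]
    by (simp add: vimage_def Int_def)
  moreover have "b \<in> {x \<in> W. \<phi> x \<in> {\<phi> a<..}}"
    using b min[of b] WR by auto
  ultimately obtain r where r: "r > 0" "cball b r \<subseteq> {x \<in> W. \<phi> x \<in> {\<phi> a<..}}"
    by (meson open_contains_cball)
  then have "continuous_on (cball b r) \<phi>"
    using WR by (intro continuous_on_subset[OF cont]) auto
  from ex_proximal_subgradient_in_ball[OF this r(1)] obtain u v K
    where u: "u \<in> ball b r"
      and prox: "\<And>y. y \<in> cball b r \<Longrightarrow> \<phi> u + v \<bullet> (y - u) - K * (norm (y - u))\<^sup>2 \<le> \<phi> y"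
    by blast
  have uW: "u \<in> W" "\<phi> a < \<phi> u"
    using subsetD[OF r(2), of u] u by auto
  then have near: "u \<in> U" "u \<in> ball a (R / 2)" "\<phi> u < \<phi> a + m"
    using WP by auto
  have "\<forall>\<^sub>F y in nhds u. y \<in> ball b r"
    using u by (intro eventually_nhds_in_open) auto
  then have v: "regular_subgradient \<phi> u v"
    by (intro proximal_imp_regular_subgradient[where K = K])
      (auto elim!: eventually_mono intro!: prox)
  have "sqrt (\<phi> u - \<phi> a) < R / 2"
    using near m uW R by (intro real_less_lsqrt) auto
  then have sub: "y \<in> ball a R" if "y \<in> cball u (sqrt (\<phi> u - \<phi> a))" for y
    using near that dist_triangle[of a y u] by simp
  have "norm v \<le> (1 + L) * sqrt (\<phi> u - \<phi> a)"
  proof (rule norm_le_sqrt_if_quadratic_upper_bound)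
    fix y assume y: "y \<in> cball u (sqrt (\<phi> u - \<phi> a))"
    show "\<phi> y \<le> \<phi> u + v \<bullet> (y - u) + L * (norm (y - u))\<^sup>2"
      unfolding \<phi>_def
      by (rule regular_subgradient_quadratic_upper_bound[OF open_ball convex_ball _ _ g G h])
        (use uW WR sub[OF y] v in \<open>auto simp: \<phi>_def\<close>)
    show "\<phi> u - (\<phi> u - \<phi> a) \<le> \<phi> y"
      using min[OF sub[OF y]] by simp
  qed (use uW lipschitz_on_nonneg[OF G] in auto)
  moreover have "u \<in> ball a R" "\<phi> u < \<phi> a + \<epsilon>"
    using uW WR near m by auto
  ultimately show thesis
    using that near uW v by blast
qed

section \<open>Failure of the exponent PLK property\<close>

lemma econvex_imp_convex_on:
  assumes f: "econvex f" and S: "convex S" and fin: "\<And>x. x \<in> S \<Longrightarrow> \<bar>f x\<bar> \<noteq> \<infinity>"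
  shows "convex_on S (\<lambda>x. real_of_ereal (f x))"
proof (rule convex_onI[OF _ S])
  fix t :: real and x y assume *: "0 < t" "t < 1" "x \<in> S" "y \<in> S"
  define z where "z = (1 - t) *\<^sub>R x + t *\<^sub>R y"
  have "z \<in> S"
    unfolding z_def using * S by (intro convexD) auto
  moreover have "f z \<le> ereal (1 - t) * f x + ereal t * f y"
    using f * unfolding econvex_def z_def by blast
  ultimately show "real_of_ereal (f z) \<le> (1 - t) * real_of_ereal (f x) + t * real_of_ereal (f y)"
    using fin[of x] fin[of y] fin[of z] *
    by (cases "f x"; cases "f y"; cases "f z") auto
qed

theorem theorem7:
  fixes g h :: "real ^ 'n \<Rightarrow> ereal" and xb :: "real ^ 'n" and q :: real
  assumes h_proper_range: "\<And>x. h x \<noteq> - \<infinity>"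
    and h_lsc: "lsc h"
    and h_convex: "econvex h"
    and xb_interior: "xb \<in> interior {x. h x < \<infinity>}"
    and xb_min: "local_minimizer (\<lambda>x. g x - h x) xb"
    and g_C11: "C11_around g xb"
    and not_locally_constant: "\<not> (\<forall>\<^sub>F x in nhds xb. g x - h x = g xb - h xb)"
    and q: "0 < q" "q < 1 / 2"
  shows "\<not> exponent_PLK (\<lambda>x. g x - h x) xb q"
proof
  assume "exponent_PLK (\<lambda>x. g x - h x) xb q"
  then obtain M \<eta> :: real and U where M: "M > 0" and \<eta>: "\<eta> > 0" and U: "open U" "xb \<in> U"
    and PLK: "\<And>x. x \<in> U \<Longrightarrow> g xb - h xb < g x - h x \<Longrightarrow> g x - h x < g xb - h xb + ereal \<eta> \<Longrightarrow>
      1 \<le> ereal (M * (1 - q) * real_of_ereal (g x - h x - (g xb - h xb)) powr (- q))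
         * dist_zero (limiting_subdifferential (\<lambda>x. g x - h x) x)"
    unfolding exponent_PLK_def by blast
  obtain S G L where S: "open S" "xb \<in> S"
    and gS: "\<forall>x\<in>S. \<bar>g x\<bar> \<noteq> \<infinity> \<and> (GDERIV (\<lambda>u. real_of_ereal (g u)) x :> G x)"
    and GL: "L-lipschitz_on S G"
    using g_C11 unfolding C11_around_def by (elim exE conjE)
  have "\<forall>\<^sub>F x in nhds xb. x \<in> S \<inter> interior {x. h x < \<infinity>}"
    using S xb_interior by (intro eventually_nhds_in_open) auto
  then have "\<forall>\<^sub>F x in nhds xb. x \<in> S \<and> h x < \<infinity> \<and> g xb - h xb \<le> g x - h x"
    using xb_min unfolding local_minimizer_def
    by eventually_elim (use interior_subset[of "{x. h x < \<infinity>}"] in blast)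
  then obtain R where R: "R > 0"
    and ball: "\<And>x. x \<in> ball xb R \<Longrightarrow> x \<in> S \<and> h x < \<infinity> \<and> g xb - h xb \<le> g x - h x"
    unfolding eventually_nhds_metric mem_ball by (metis dist_commute)
  define gr hr where "gr = (\<lambda>x. real_of_ereal (g x))" and "hr = (\<lambda>x. real_of_ereal (h x))"
  define f where "f = (\<lambda>x. gr x - hr x)"
  have h_fin: "\<bar>h x\<bar> \<noteq> \<infinity>" if "x \<in> ball xb R" for x
    using ball[OF that] h_proper_range[of x] by auto
  have f: "g x - h x = ereal (f x)" if "x \<in> ball xb R" for x
    using gS ball[OF that] h_fin[OF that] unfolding f_def gr_def hr_def
    by (cases "g x"; cases "h x") auto
  have xb: "xb \<in> ball xb R"
    using R by simp
  have near: "\<forall>\<^sub>F x in nhds x0. g x - h x = ereal (f x)" if "x0 \<in> ball xb R" for x0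
    using eventually_nhds_in_open[OF open_ball that] by eventually_elim (rule f)
  \<comment> \<open>Inserting \<open>norm v \<le> (1 + L) * sqrt \<delta>\<close> into the PLK inequality gives \<open>1 \<le> C * \<delta> powr (1 / 2 - q)\<close>,
    which fails for small \<open>\<delta>\<close> because the exponent is positive.\<close>
  define C where "C = M * (1 - q) * (1 + L)"
  have hr: "convex_on (ball xb R) hr"
    unfolding hr_def by (rule econvex_imp_convex_on[OF h_convex convex_ball h_fin])
  have gr: "GDERIV gr x :> G x" if "x \<in> ball xb R" for x
    unfolding gr_def using gS ball[OF that] by blast
  have GR: "L-lipschitz_on (ball xb R) G"
    using ball by (intro lipschitz_on_subset[OF GL]) auto
  have "((\<lambda>t. C * t powr (1 / 2 - q)) \<longlongrightarrow> C * 0) (at_right 0)"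
    using q by (intro tendsto_mult tendsto_const tendsto_zero_powrI[OF tendsto_ident_at tendsto_const])
      (auto simp: eventually_at_filter)
  then have "\<forall>\<^sub>F t in at_right 0. C * t powr (1 / 2 - q) < 1"
    by (rule order_tendstoD(2)) simp
  then obtain \<epsilon> where \<epsilon>: "\<epsilon> > 0" and C: "\<And>t. 0 < t \<Longrightarrow> t < \<epsilon> \<Longrightarrow> C * t powr (1 / 2 - q) < 1"
    unfolding eventually_at_right_field by blast
  have nonconst: "\<not> (\<forall>\<^sub>F x in nhds xb. f x = f xb)"
  proof
    assume "\<forall>\<^sub>F x in nhds xb. f x = f xb"
    with near[OF xb] have "\<forall>\<^sub>F x in nhds xb. g x - h x = g xb - h xb"
      by eventually_elim (simp add: f[OF xb])
    with not_locally_constant show False ..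
  qed
  have min: "f xb \<le> f x" if "x \<in> ball xb R" for x
    using ball[OF that] f[OF that] f[OF xb] by simp
  have "min \<eta> \<epsilon> > 0"
    using \<eta> \<epsilon> by simp
  from ex_small_regular_subgradient[OF f_def R gr GR hr min nonconst U this]
  obtain u v where u: "u \<in> ball xb R" "u \<in> U" "f xb < f u" "f u < f xb + min \<eta> \<epsilon>"
    and v: "regular_subgradient f u v" "norm v \<le> (1 + L) * sqrt (f u - f xb)"
    by blast
  define \<delta> where "\<delta> = f u - f xb"
  have \<delta>: "\<delta> > 0" "\<delta> < \<epsilon>"
    using u by (auto simp: \<delta>_def)
  have "1 \<le> ereal (M * (1 - q) * \<delta> powr (- q))
      * dist_zero (limiting_subdifferential (\<lambda>x. g x - h x) u)"
    using PLK[OF u(2)] u f[OF u(1)] f[OF xb] by (simp add: \<delta>_def)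
  also have "\<dots> \<le> ereal (M * (1 - q) * \<delta> powr (- q)) * ereal (norm v)"
  proof (rule ereal_mult_left_mono)
    show "dist_zero (limiting_subdifferential (\<lambda>x. g x - h x) u) \<le> ereal (norm v)"
      unfolding dist_zero_def
      by (rule INF_lower)
        (rule regular_subgradient_imp_limiting_subdifferential[OF near[OF u(1)] v(1)])
  qed (use M q in simp)
  finally have "1 \<le> M * (1 - q) * \<delta> powr (- q) * norm v"
    by simp
  also have "\<dots> \<le> M * (1 - q) * \<delta> powr (- q) * ((1 + L) * sqrt \<delta>)"
    using v(2) M q by (intro mult_left_mono) (auto simp: \<delta>_def)
  also have "\<dots> = C * \<delta> powr (1 / 2 - q)"
    using \<delta> by (simp add: C_def powr_half_sqrt powr_diff powr_minus_divide)
  finally show False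
    using C[OF \<delta>] by simp
qed

end
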